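(* There exist infinitely many ordinary odd primes $m\notin J$, and infinitely many ordinary integers $m\notin J$ of the form $m=pq$ with $p,q$ odd primes satisfying $p<q<4p$.
   Context: For odd $m\ge 3$ let $\mathbb{Z}_m=\mathbb{Z}/m\mathbb{Z}$. A Cayley subset of $\mathbb{Z}_m$ is a subset $S$ with $0\notin S$, $S=-S$, generating $\mathbb{Z}_m$. $X(S)$ is the Cayley graph on $\mathbb{Z}_m$ ($x\sim y$ iff $y-x\in S$), with non-trivial eigenvalues $\mu_j(S)=\sum_{a\in S}e^{2\pi i a j/m}$ ($1\le j\le m-1$) and $\mu(S)=\max_j|\mu_j(S)|$; it is Ramanujan if $\mu(S)\le 2\sqrt{|S|-1}$. The covalency is $l(S)=m-|S|$. $\hat{l}$ is the largest covalency value $l$ such that $X(S)$ is Ramanujan for every Cayley subset $S$ with $l(S)\le l$. An odd $m\ge 15$ is ordinary if $\hat{l}=l_0:=2\lfloor\sqrt{m}-\frac32\rfloor+1$. $J=\{2n+1: 7\le n\le 14\}\cup\{k^2+5k+c: k\ge 4,\ c\in\{\pm1,\pm3,5\}\}\cup\{k^2+5k-5: k\ge 19\}$. *)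

theory Defs
  imports
    "HOL-Analysis.Analysis"
    "HOL-Algebra.Elementary_Groups"
    "HOL-Computational_Algebra.Primes"
begin

text \<open>The group \<open>\<int>\<^sub>m\<close> is \<^const>\<open>integer_mod_group\<close>, whose carrier is \<open>{0..<int m}\<close> for \<open>m > 0\<close>
  and whose (additively understood) operation is written multiplicatively in the library.\<close>

definition cayley_subset :: "nat \<Rightarrow> int set \<Rightarrow> bool" where
  "cayley_subset m S \<longleftrightarrow>
     S \<subseteq> carrier (integer_mod_group m) \<and> 0 \<notin> S \<and>
     (\<lambda>a. inv\<^bsub>integer_mod_group m\<^esub> a) ` S = S \<and>
     generate (integer_mod_group m) S = carrier (integer_mod_group m)"

definition cayley_adj :: "nat \<Rightarrow> int set \<Rightarrow> int \<Rightarrow> int \<Rightarrow> bool" where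
  "cayley_adj m S x y \<longleftrightarrow>
     x \<in> carrier (integer_mod_group m) \<and> y \<in> carrier (integer_mod_group m) \<and>
     y \<otimes>\<^bsub>integer_mod_group m\<^esub> (inv\<^bsub>integer_mod_group m\<^esub> x) \<in> S"

definition cayley_eigenvalue :: "nat \<Rightarrow> int set \<Rightarrow> nat \<Rightarrow> complex" where
  "cayley_eigenvalue m S j =
     (\<Sum>a\<in>S. exp (2 * of_real pi * \<i> * of_int a * of_nat j / of_nat m))"

text \<open>The numbers above are the eigenvalues of the adjacency operator of the Cayley graph: the
  \<open>j\<close>-th character of \<open>\<int>\<^sub>m\<close> is an eigenvector for the \<open>j\<close>-th one.\<close>

lemma character_mod:
  assumes "m > 0"
  shows "exp (2 * of_real pi * \<i> * of_int (b mod int m) * of_nat j / of_nat m) =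
         exp (2 * of_real pi * \<i> * of_int b * of_nat j / of_nat m)"
proof -
  have "(of_int b :: complex) = of_int (int m * (b div int m) + b mod int m)"
    by simp
  then have b: "(of_int b :: complex) = of_nat m * of_int (b div int m) + of_int (b mod int m)"
    by (simp only: of_int_add of_int_mult of_int_of_nat_eq)
  have "2 * of_real pi * \<i> * of_int b * of_nat j / of_nat m =
        2 * of_int (b div int m * int j) * of_real pi * \<i> +
        2 * of_real pi * \<i> * of_int (b mod int m) * of_nat j / (of_nat m :: complex)"
    unfolding b using assms by (simp add: field_simps)
  moreover have "exp (2 * of_int (b div int m * int j) * of_real pi * \<i>) = 1"
    using exp_integer_2pi[of "of_int (b div int m * int j)"] by simp
  ultimately show ?thesis
    by (simp only: exp_add mult_1)
qed

lemma cayley_eigenvalue_eigenvector: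
  assumes "m > 0" and S: "cayley_subset m S" and x: "x \<in> carrier (integer_mod_group m)"
  shows "(\<Sum>y | cayley_adj m S x y. exp (2 * of_real pi * \<i> * of_int y * of_nat j / of_nat m)) =
         cayley_eigenvalue m S j * exp (2 * of_real pi * \<i> * of_int x * of_nat j / of_nat m)"
proof -
  have car: "carrier (integer_mod_group m) = {0..<int m}"
    using assms(1) by (simp add: carrier_integer_mod_group)
  have SS: "a \<in> S \<Longrightarrow> a mod int m = a" for a
    using S by (auto simp: cayley_subset_def car)
  have adj: "cayley_adj m S x y \<longleftrightarrow> y \<in> {0..<int m} \<and> (y - x) mod int m \<in> S" for y
    using x by (simp add: cayley_adj_def car mod_add_right_eq)
  have "(\<Sum>y | cayley_adj m S x y. exp (2 * of_real pi * \<i> * of_int y * of_nat j / of_nat m)) =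
        (\<Sum>a\<in>S. exp (2 * of_real pi * \<i> * of_int ((x + a) mod int m) * of_nat j / of_nat m))"
    by (rule sum.reindex_bij_witness
          [where i = "\<lambda>a. (x + a) mod int m" and j = "\<lambda>y. (y - x) mod int m"])
       (use assms(1) SS in \<open>auto simp: adj mod_simps\<close>)
  also have "\<dots> = (\<Sum>a\<in>S. exp (2 * of_real pi * \<i> * of_int a * of_nat j / of_nat m) *
                    exp (2 * of_real pi * \<i> * of_int x * of_nat j / of_nat m))"
    unfolding character_mod[OF assms(1)]
    by (intro sum.cong refl) (simp add: exp_add[symmetric] algebra_simps add_divide_distrib)
  finally show ?thesis
    by (simp add: cayley_eigenvalue_def sum_distrib_right)
qed

definition cayley_mu :: "nat \<Rightarrow> int set \<Rightarrow> real" where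
  "cayley_mu m S = Max ((\<lambda>j. norm (cayley_eigenvalue m S j)) ` {1..m - 1})"

definition ramanujan :: "nat \<Rightarrow> int set \<Rightarrow> bool" where
  "ramanujan m S \<longleftrightarrow> cayley_mu m S \<le> 2 * sqrt (real (card S) - 1)"

definition covalency :: "nat \<Rightarrow> int set \<Rightarrow> nat" where
  "covalency m S = m - card S"

text \<open>For odd \<open>m \<ge> 3\<close> the set below is finite, and nonempty because the complete graph
  (covalency \<open>1\<close>) is Ramanujan, so the maximum is meaningful.\<close>

definition hat_l :: "nat \<Rightarrow> nat" where
  "hat_l m = Max {l. (\<exists>S. cayley_subset m S \<and> covalency m S = l) \<and>
                     (\<forall>S. cayley_subset m S \<and> covalency m S \<le> l \<longrightarrow> ramanujan m S)}"

definition l_zero :: "nat \<Rightarrow> int" where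
  "l_zero m = 2 * \<lfloor>sqrt (real m) - 3 / 2\<rfloor> + 1"

definition ordinary :: "nat \<Rightarrow> bool" where
  "ordinary m \<longleftrightarrow> odd m \<and> m \<ge> 15 \<and> int (hat_l m) = l_zero m"

definition J :: "int set" where
  "J = {2 * n + 1 | n. 7 \<le> n \<and> n \<le> 14}
     \<union> {k\<^sup>2 + 5 * k + c | k c. 4 \<le> k \<and> c \<in> {-1, 1, -3, 3, 5}}
     \<union> {k\<^sup>2 + 5 * k - 5 | k. 19 \<le> k}"

end

theory Submission
  imports Defs "HOL-Computational_Algebra.Squarefree"
begin

text \<open>Passing to the complement \<open>T\<close> of \<open>S\<close> in \<open>\<int>\<^sub>m\<close>, which only changes the sign of the non-trivial
  eigenvalues, gives \<open>\<mu>(S) \<le> l(S)\<close>, and \<open>l\<^sub>0\<close> is the largest odd \<open>l\<close> with \<open>l \<le> 2 sqrt (m - l - 1)\<close>,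
  i.e. \<open>(l + 2)\<^sup>2 \<le> 4 m\<close>. For \<open>l = l\<^sub>0 + 2\<close> and \<open>T = {-t..t}\<close> with \<open>2 t + 1 = l\<close>, the bound
  \<open>cos x \<ge> 1 - x\<^sup>2 / 2\<close> shows that the eigenvalue \<open>\<mu>\<^sub>1\<close> violates the Ramanujan bound as soon as the
  odd square \<open>(l + 2)\<^sup>2\<close> exceeds \<open>4 m\<close> by a suitable constant. Membership in \<^const>\<open>J\<close> forces \<open>4 m\<close> to lie
  just below an odd square, so it suffices to find \<open>m\<close> with no odd square in \<open>{4 m<..<4 m + 100}\<close>.

  The exceptional \<open>m\<close> are as sparse as the squares, whereas the sum of the reciprocals of the primes
  diverges; hence infinitely many primes are not exceptional. The same divergence yields infinitely
  many primes \<open>p < q\<close> with \<open>(q - p)\<^sup>2 < p\<close>; then \<open>4 p q = (p + q)\<^sup>2 - (q - p)\<^sup>2\<close> lies just below an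
  even square and thus far from the next odd one.\<close>

section \<open>Primes and sets as sparse as the squares\<close>

text \<open>Erdos' argument: if the primes outside a finite set \<open>F\<close> had small reciprocal sum, most
  \<open>n \<le> N\<close> would have all their prime factors in \<open>F\<close>; but such an \<open>n\<close> is determined by its square part
  and a subset of \<open>F\<close>, which leaves only \<open>O(sqrt N)\<close> of them.\<close>

lemma not_summable_on_inverse_primes: "\<not> (\<lambda>p. 1 / real p) summable_on {p :: nat. prime p}"
proof
  define f where "f = (\<lambda>p :: nat. 1 / real p)"
  define P where "P = {p :: nat. prime p}"
  assume "(\<lambda>p. 1 / real p) summable_on {p :: nat. prime p}"
  then have f: "f summable_on P"
    by (simp add: f_def P_def)
  then obtain F where F: "finite F" "F \<subseteq> P" "dist (sum f F) (infsum f P) \<le> 1 / 4"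
    using has_sum_finite_approximation[OF has_sum_infsum, of f P "1 / 4"] by auto
  have tail: "sum f G \<le> 1 / 4" if "finite G" "G \<subseteq> P - F" for G
  proof -
    have "sum f F + sum f G = sum f (F \<union> G)"
      using that F by (intro sum.union_disjoint[symmetric]) auto
    also have "\<dots> \<le> infsum f P"
      using that F f by (intro finite_sum_le_infsum) (auto simp: f_def)
    finally show ?thesis
      using F(3) unfolding dist_real_def by linarith
  qed
  define k where "k = card F"
  \<comment> \<open>With this choice the final count \<open>2 ^ k * M\<close> is half of
    \<open>N\<close>, whereas the union bound leaves at least three quarters of \<open>N\<close> for
    \<open>A\<close>.\<close>
  define M :: nat where "M = 2 ^ (k + 1)"
  define N where "N = M ^ 2"
  define G where "G = {p \<in> P - F. p \<le> N}"
  define A where "A = {n \<in> {1..N}. prime_factors n \<subseteq> F}"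
  have finG: "finite G" by (rule finite_subset[of _ "{..N}"]) (auto simp: G_def)
  have "{1..N} \<subseteq> A \<union> (\<Union>p\<in>G. {n \<in> {1..N}. p dvd n})"
  proof
    fix n assume n: "n \<in> {1..N}"
    show "n \<in> A \<union> (\<Union>p\<in>G. {n \<in> {1..N}. p dvd n})"
    proof (cases "prime_factors n \<subseteq> F")
      case False
      then obtain p where p: "prime p" "p dvd n" "p \<notin> F"
        by (auto simp: in_prime_factors_iff)
      moreover have "p \<le> n" using p n by (intro dvd_imp_le) auto
      ultimately show ?thesis using n by (auto simp: G_def P_def)
    qed (use n in \<open>auto simp: A_def\<close>)
  qed
  then have "card {1..N} \<le> card (A \<union> (\<Union>p\<in>G. {n \<in> {1..N}. p dvd n}))"
    using finG by (intro card_mono) (auto simp: A_def)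
  also have "\<dots> \<le> card A + (\<Sum>p\<in>G. card {n \<in> {1..N}. p dvd n})"
    by (rule order_trans[OF card_Un_le add_left_mono[OF card_UN_le[OF finG]]])
  finally have "real N \<le> real (card A) + (\<Sum>p\<in>G. real (card {n \<in> {1..N}. p dvd n}))"
    by (simp flip: of_nat_sum of_nat_add)
  also have "(\<Sum>p\<in>G. real (card {n \<in> {1..N}. p dvd n})) \<le> (\<Sum>p\<in>G. real N * f p)"
  proof (rule sum_mono)
    fix p assume "p \<in> G"
    then have p: "p > 0" by (auto simp: G_def P_def prime_gt_0_nat)
    have "{n \<in> {1..N}. p dvd n} \<subseteq> (\<lambda>i. p * i) ` {1..N div p}"
    proof
      fix n assume "n \<in> {n \<in> {1..N}. p dvd n}"
      then obtain i where "n = p * i" "1 \<le> n" "n \<le> N" by auto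
      moreover from this p have "i \<le> N div p"
        by (metis div_le_mono nonzero_mult_div_cancel_left not_gr_zero)
      moreover have "1 \<le> i" using calculation by (cases i) auto
      ultimately show "n \<in> (\<lambda>i. p * i) ` {1..N div p}" by auto
    qed
    then have "card {n \<in> {1..N}. p dvd n} \<le> card ((\<lambda>i. p * i) ` {1..N div p})"
      by (intro card_mono) auto
    also have "\<dots> \<le> N div p"
      using card_image_le[of "{1..N div p}" "\<lambda>i. p * i"] by simp
    finally have "real (card {n \<in> {1..N}. p dvd n}) \<le> real (N div p)" by simp
    also have "\<dots> \<le> real N / real p"
      using p by (simp add: pos_le_divide_eq flip: of_nat_mult)
    finally show "real (card {n \<in> {1..N}. p dvd n}) \<le> real N * f p"
      by (simp add: f_def)
  qed
  also have "\<dots> \<le> real N * (1 / 4)"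
    unfolding sum_distrib_left[symmetric] using finG
    by (intro mult_left_mono tail) (auto simp: G_def)
  finally have 1: "3 * real N \<le> 4 * real (card A)" by simp
  have "card A \<le> card (Pow F \<times> {1..M})"
  proof (rule card_inj_on_le)
    \<comment> \<open>The primes of odd multiplicity determine the squarefree part, and together
      with the square part this determines \<open>n\<close>.\<close>
    let ?g = "\<lambda>n. ({p. prime p \<and> odd (multiplicity p n)}, square_part n)"
    show "inj_on ?g A"
    proof (rule inj_onI)
      fix x y assume eq: "?g x = ?g y" and xy: "x \<in> A" "y \<in> A"
      have "squarefree_part x = squarefree_part y"
      proof (rule multiplicity_eq_nat)
        fix p :: nat assume p: "prime p"
        then have "odd (multiplicity p x) \<longleftrightarrow> odd (multiplicity p y)" using eq by auto
        then show "multiplicity p (squarefree_part x) = multiplicity p (squarefree_part y)"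
          using p by (simp add: prime_multiplicity_squarefree_part)
             (metis mod2_eq_if)
      qed (use squarefree_part_nonzero in \<open>blast intro: Nat.gr0I\<close>)+
      moreover have "square_part x = square_part y" using eq by simp
      ultimately show "x = y" by (rule squarefree_decomposition_unique[rotated])
    qed
    show "?g ` A \<subseteq> Pow F \<times> {1..M}"
    proof
      fix z assume "z \<in> ?g ` A"
      then obtain n where z: "z = ?g n" and n: "1 \<le> n" "n \<le> N" "prime_factors n \<subseteq> F"
        by (auto simp: A_def)
      have "{p. prime p \<and> odd (multiplicity p n)} \<subseteq> prime_factors n"
        using n(1) by (auto simp: prime_factors_multiplicity intro!: Nat.gr0I)
      moreover have "square_part n ^ 2 \<le> n"
        using n(1) by (intro dvd_imp_le) auto
      then have "square_part n \<le> M"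
        using n(2) unfolding N_def by (meson le_trans power2_nat_le_eq_le)
      moreover have "1 \<le> square_part n" using n(1) by (cases "square_part n") auto
      ultimately show "z \<in> Pow F \<times> {1..M}" using z n by auto
    qed
  qed (use F in auto)
  also have "\<dots> = 2 ^ k * M"
    using F by (simp add: card_cartesian_product card_Pow k_def)
  finally have "2 * card A \<le> N"
    by (simp add: N_def M_def power2_eq_square)
  moreover have "N > 0" by (simp add: N_def M_def)
  ultimately show False using 1 by linarith
qed

text \<open>The values of \<open>f\<close> are distinct and \<open>1 / n <= C / (f n)^2\<close>, so
  the reciprocals over \<open>A\<close> are dominated by the convergent sum of
  \<open>C / k^2\<close>. Finitely many further primes would not make the sum diverge.\<close>

lemma infinite_primes_outside_sparse:
  fixes f :: "nat \<Rightarrow> nat" and C :: nat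
  assumes inj: "inj_on f A" and pos: "\<And>n. n \<in> A \<Longrightarrow> 0 < n \<and> 0 < f n"
    and bound: "\<And>n. n \<in> A \<Longrightarrow> f n ^ 2 \<le> C * n"
  shows "infinite ({p. prime p} - A)"
proof
  assume fin: "finite ({p. prime p} - A)"
  have "(\<lambda>k. 1 / real k ^ 2) summable_on (UNIV :: nat set)"
    using inverse_power_summable[of 2, where 'a = real]
    by (intro norm_summable_imp_summable_on) (simp add: inverse_eq_divide)
  then have "(\<lambda>k. 1 / real k ^ 2) summable_on f ` A"
    using summable_on_subset_banach by blast
  then have "(\<lambda>n. 1 / real (f n) ^ 2) summable_on A"
    by (simp add: summable_on_reindex[OF inj] o_def)
  then have "(\<lambda>n. real C * (1 / real (f n) ^ 2)) summable_on A"
    by (rule summable_on_cmult_right)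
  then have "(\<lambda>n. 1 / real n) summable_on A"
  proof (rule summable_on_comparison_test)
    fix n assume n: "n \<in> A"
    have "real (f n) ^ 2 \<le> real C * real n"
      using bound[OF n] by (metis of_nat_le_iff of_nat_mult of_nat_power)
    then show "1 / real n \<le> real C * (1 / real (f n) ^ 2)"
      using pos[OF n] by (simp add: field_simps)
  qed auto
  then have "(\<lambda>n. 1 / real n) summable_on A \<union> ({p. prime p} - A)"
    using fin by (intro summable_on_Un_disjoint) auto
  then have "(\<lambda>n. 1 / real n) summable_on {p. prime p}"
    by (rule summable_on_subset_banach) auto
  then show False using not_summable_on_inverse_primes by blast
qed

text \<open>Otherwise the primes from \<open>N\<close> on would be as sparse as the squares,
  although only finitely many primes lie outside this set.\<close>

lemma exists_close_primes:
  "\<exists>p q :: nat. prime p \<and> prime q \<and> N \<le> p \<and> p < q \<and> (q - p)\<^sup>2 < p"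
proof (rule ccontr)
  assume neg: "\<not> ?thesis"
  define A where "A = {p :: nat. prime p \<and> N \<le> p}"
  txt \<open>If \<open>q \<ge> p + sqrt p\<close> for all primes \<open>p < q\<close> beyond \<open>N\<close>, then \<open>3 sqrt p\<close> grows by at least \<open>1\<close>
    from each prime to the next.\<close>
  define f where "f = (\<lambda>p :: nat. nat \<lfloor>3 * sqrt (real p)\<rfloor>)"
  have "infinite ({p. prime p} - A)"
  proof (rule infinite_primes_outside_sparse[where f = f and C = 9])
    have "f p < f q" if "p \<in> A" "q \<in> A" "p < q" for p q
    proof -
      have p: "1 \<le> real p" using that prime_gt_0_nat[of p] by (auto simp: A_def)
      have "p \<le> (q - p)\<^sup>2" using neg that unfolding A_def by (metis mem_Collect_eq not_less)
      then have "real p \<le> (real q - real p)\<^sup>2"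
        using that(3) by (metis of_nat_le_iff of_nat_power of_nat_diff less_imp_le)
      then have "sqrt (real p) \<le> real q - real p"
        using that(3) by (intro real_le_lsqrt) auto
      moreover have "1 \<le> sqrt (real p)" using p by simp
      \<comment> \<open>The factor 3 in \<open>f\<close> matters here:
        \<open>9 * sqrt p >= 6 * sqrt p + 1\<close>, which completes the square.\<close>
      ultimately have "9 * real p + 6 * sqrt (real p) + 1 \<le> 9 * real q" by linarith
      then have "(3 * sqrt (real p) + 1)\<^sup>2 \<le> (3 * sqrt (real q))\<^sup>2"
        by (simp add: power2_sum power_mult_distrib)
      then have "3 * sqrt (real p) + 1 \<le> 3 * sqrt (real q)"
        by (rule power2_le_imp_le) auto
      then have "\<lfloor>3 * sqrt (real p)\<rfloor> + 1 \<le> \<lfloor>3 * sqrt (real q)\<rfloor>"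
        by (metis floor_mono floor_add_int of_int_1)
      moreover have "0 \<le> \<lfloor>3 * sqrt (real p)\<rfloor>" by simp
      ultimately show ?thesis unfolding f_def by linarith
    qed
    then show "inj_on f A"
      by (metis linorder_inj_onI' less_irrefl)
  next
    fix p assume "p \<in> A"
    then have p: "0 < p" by (auto simp: A_def prime_gt_0_nat)
    then have "1 \<le> sqrt (real p)" by simp
    then have "1 \<le> \<lfloor>3 * sqrt (real p)\<rfloor>" by linarith
    then show "0 < p \<and> 0 < f p" using p by (simp add: f_def)
    have "real (f p) \<le> 3 * sqrt (real p)" by (simp add: f_def)
    then have "real (f p) ^ 2 \<le> (3 * sqrt (real p)) ^ 2"
      by (intro power_mono) auto
    then have "real (f p ^ 2) \<le> real (9 * p)" by (simp add: power_mult_distrib)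
    then show "f p ^ 2 \<le> 9 * p" by (simp only: of_nat_le_iff)
  qed
  moreover have "{p. prime p} - A \<subseteq> {..N}" by (auto simp: A_def)
  ultimately show False using finite_subset by blast
qed

section \<open>Eigenvalues of circulant graphs\<close>

lemma cos_ge_one_minus_square_half: "1 - x\<^sup>2 / 2 \<le> cos (x :: real)"
proof -
  have "\<bar>sin (x / 2)\<bar>\<^sup>2 \<le> \<bar>x / 2\<bar>\<^sup>2"
    by (intro power_mono abs_sin_x_le_abs_x) auto
  then show ?thesis
    using cos_double_sin[of "x / 2"] by (simp add: power_divide)
qed

text \<open>Negation has no fixed point in \<open>S\<close>, since \<open>m\<close> is odd and 0 is
  excluded. Hence all covalencies are odd.\<close>

lemma card_cayley_subset_even:
  assumes "odd m" "cayley_subset m S"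
  shows "even (card S)"
proof -
  have m: "m > 0" using assms by (auto intro: Nat.gr0I)
  have S: "S \<subseteq> {0..<int m}" "0 \<notin> S" "(\<lambda>a. inv\<^bsub>integer_mod_group m\<^esub> a) ` S = S"
    using assms m by (auto simp: cayley_subset_def carrier_integer_mod_group)
  have inv: "inv\<^bsub>integer_mod_group m\<^esub> a = int m - a" if "a \<in> S" for a
  proof -
    have "a \<noteq> 0" using that S(2) by metis
    then have "a \<in> carrier (integer_mod_group m)" "0 < a" "a < int m"
      using that S(1) m by (auto simp: carrier_integer_mod_group subset_iff)
    then show ?thesis by (simp add: zmod_zminus1_eq_if)
  qed
  have refl: "int m - a \<in> S" if "a \<in> S" for a
    using S(3) inv[OF that] that by (metis imageI)
  define H where "H = {a \<in> S. 2 * a < int m}"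
  have fin: "finite S" using S(1) finite_subset by blast
  have "S = H \<union> (\<lambda>a. int m - a) ` H"
  proof (intro subset_antisym subsetI)
    fix a assume a: "a \<in> S"
    have "2 * a \<noteq> int m" using assms(1) by presburger
    then show "a \<in> H \<union> (\<lambda>a. int m - a) ` H"
      using a refl[OF a] by (cases "2 * a < int m") (auto simp: H_def image_iff intro!: bexI[of _ "int m - a"])
  qed (use refl in \<open>auto simp: H_def\<close>)
  moreover have "card (H \<union> (\<lambda>a. int m - a) ` H) = card H + card ((\<lambda>a. int m - a) ` H)"
    using fin by (intro card_Un_disjoint) (auto simp: H_def)
  moreover have "card ((\<lambda>a. int m - a) ` H) = card H"
    by (intro card_image) (auto simp: inj_on_def)
  ultimately show ?thesis by simp
qed

lemma sum_characters_eq_0: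
  assumes "1 \<le> j" "j < m"
  shows "(\<Sum>a\<in>{0..<int m}. exp (2 * of_real pi * \<i> * of_int a * of_nat j / of_nat m)) = (0 :: complex)"
proof -
  define z :: complex where "z = exp (2 * of_real pi * \<i> * of_nat j / of_nat m)"
  have "z \<noteq> 1"
  proof
    assume "z = 1"
    then obtain n :: int where "2 * pi * real j / real m = of_int (2 * n) * pi"
      by (auto simp: z_def exp_eq_1)
    then have "real j = of_int n * real m"
      using assms by (simp add: field_simps)
    then have "int j = n * int m"
      by (metis of_int_eq_iff of_int_mult of_int_of_nat_eq)
    then have "m dvd j" by (metis dvd_triv_right int_dvd_int_iff)
    then show False using assms by (auto dest: dvd_imp_le)
  qed
  moreover have "z ^ m = 1"
    using assms by (auto simp: z_def exp_of_nat_mult[symmetric] exp_eq_1 intro!: exI[of _ "int j"])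
  ultimately have "(\<Sum>a<m. z ^ a) = 0"
    by (simp add: geometric_sum)
  moreover have "(\<Sum>a\<in>{0..<int m}. exp (2 * of_real pi * \<i> * of_int a * of_nat j / of_nat m)) = (\<Sum>a<m. z ^ a)"
    by (rule sum.reindex_bij_witness[where i = int and j = nat])
       (auto simp: z_def exp_of_nat_mult[symmetric] mult_ac)
  ultimately show ?thesis by simp
qed

lemma cayley_eigenvalue_complement:
  assumes "S \<subseteq> {0..<int m}" "1 \<le> j" "j < m"
  shows "cayley_eigenvalue m S j = - cayley_eigenvalue m ({0..<int m} - S) j"
  using sum_characters_eq_0[OF assms(2,3)]
    sum.subset_diff[OF assms(1), of "\<lambda>a. exp (2 * of_real pi * \<i> * of_int a * of_nat j / of_nat m) :: complex"]
  by (simp add: cayley_eigenvalue_def eq_neg_iff_add_eq_0 add.commute)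

lemma norm_cayley_eigenvalue_le: "norm (cayley_eigenvalue m S j) \<le> real (card S)"
proof -
  have "norm (exp (2 * of_real pi * \<i> * of_int a * of_nat j / of_nat m) :: complex) = 1" for a
    by (simp add: norm_exp_eq_Re)
  then show ?thesis
    unfolding cayley_eigenvalue_def
    using sum_norm_le[of S "\<lambda>a. exp (2 * of_real pi * \<i> * of_int a * of_nat j / of_nat m) :: complex" "\<lambda>_. 1"]
    by simp
qed

lemma ramanujan_if_small_covalency:
  assumes m: "m \<ge> 3" and S: "cayley_subset m S" and l: "(covalency m S + 2)\<^sup>2 \<le> 4 * m"
  shows "ramanujan m S"
proof -
  define l where "l = covalency m S"
  have sub: "S \<subseteq> {0..<int m}"
    using S m by (auto simp: cayley_subset_def carrier_integer_mod_group)
  have fin: "finite S" using sub finite_subset by blast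
  have "card S \<le> m" using card_mono[OF _ sub] by simp
  then have card: "card S + l = m" by (simp add: l_def covalency_def)
  have compl: "card ({0..<int m} - S) = l"
    using sub fin card by (simp add: card_Diff_subset)
  have "real l ^ 2 + 4 * real l + 4 \<le> 4 * real m"
  proof -
    have "real ((l + 2)\<^sup>2) \<le> real (4 * m)" using l unfolding l_def of_nat_le_iff .
    then show ?thesis by (simp add: power2_sum algebra_simps)
  qed
  \<comment> \<open>The hypothesis rearranges to \<open>l^2 <= 4 * (m - l - 1)\<close>, and
    \<open>card S = m - l\<close>.\<close>
  then have "real l ^ 2 \<le> 4 * (real (card S) - 1)"
    using card by (simp add: algebra_simps flip: card)
  then have "real l \<le> sqrt (2\<^sup>2 * (real (card S) - 1))"
    by (simp add: real_le_rsqrt)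
  then have l: "real l \<le> 2 * sqrt (real (card S) - 1)"
    by (simp only: real_sqrt_mult real_sqrt_abs abs_numeral)
  have "norm (cayley_eigenvalue m S j) \<le> real l" if "j \<in> {1..m - 1}" for j
  proof -
    have "1 \<le> j" "j < m" using that m by auto
    then show ?thesis
      using cayley_eigenvalue_complement[OF sub, of j] compl
        norm_cayley_eigenvalue_le[of m "{0..<int m} - S" j] by simp
  qed
  then have "cayley_mu m S \<le> real l"
    unfolding cayley_mu_def using m by (intro Max.boundedI) auto
  then show ?thesis using l by (simp add: ramanujan_def)
qed

section \<open>Complements of intervals around 0\<close>

text \<open>The complement of the residues of \<open>-t, ..., t\<close>, in representatives from 0
  to \<open>m - 1\<close>.\<close>

definition middle_segment :: "nat \<Rightarrow> nat \<Rightarrow> int set" where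
  "middle_segment m t = {int t + 1..int m - 1 - int t}"

lemma covalency_middle_segment:
  "2 * t + 3 \<le> m \<Longrightarrow> covalency m (middle_segment m t) = 2 * t + 1"
  by (simp add: covalency_def middle_segment_def nat_diff_distrib)

lemma cayley_subset_middle_segment:
  assumes "odd m" "2 * t + 3 \<le> m"
  shows "cayley_subset m (middle_segment m t)"
proof -
  let ?G = "integer_mod_group m" and ?S = "middle_segment m t"
  interpret group ?G by simp
  have car: "carrier ?G = {0..<int m}" using assms by (simp add: carrier_integer_mod_group)
  have sub: "?S \<subseteq> carrier ?G" by (auto simp: car middle_segment_def)
  have inv: "inv\<^bsub>?G\<^esub> a = int m - a" if "a \<in> ?S" for a
  proof -
    have "a \<in> carrier ?G" using sub that by blast
    moreover have "0 < a" "a < int m" using that by (auto simp: middle_segment_def)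
    ultimately show ?thesis by (simp add: zmod_zminus1_eq_if)
  qed
  have "(\<lambda>a. inv\<^bsub>?G\<^esub> a) ` ?S = (\<lambda>a. int m - a) ` ?S" using inv by simp
  also have "\<dots> = ?S" by (auto simp: middle_segment_def)
  finally have inv_image: "(\<lambda>a. inv\<^bsub>?G\<^esub> a) ` ?S = ?S" .
  obtain h where h: "m = 2 * h + 1" using assms(1) by (elim oddE)
  \<comment> \<open>This element is the inverse of 2 modulo \<open>m\<close>; its double is the
    generator 1.\<close>
  have "int h + 1 \<in> ?S" using h assms(2) by (auto simp: middle_segment_def)
  then have "int h + 1 \<in> generate ?G ?S" by (rule generate.incl)
  then have "(int h + 1) \<otimes>\<^bsub>?G\<^esub> (int h + 1) \<in> generate ?G ?S"
    by (intro generate.eng)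
  moreover have "(int h + 1) \<otimes>\<^bsub>?G\<^esub> (int h + 1) = 1"
  proof -
    have "(int h + 1) + (int h + 1) = 1 + int m" using h by simp
    then show ?thesis using assms(2) by (simp only: mult_integer_mod_group) simp
  qed
  ultimately have one: "1 \<in> generate ?G ?S" by simp
  have "int k mod int m \<in> generate ?G ?S" for k
  proof (induction k)
    case 0
    show ?case using generate.one[of ?G ?S] by simp
  next
    case (Suc k)
    have "(int k mod int m) \<otimes>\<^bsub>?G\<^esub> 1 = int (Suc k) mod int m" by (simp add: mod_simps add.commute)
    then show ?case using generate.eng[OF Suc one] by metis
  qed
  then have "carrier ?G \<subseteq> generate ?G ?S"
    by (metis car atLeastLessThan_iff mod_pos_pos_trivial nonneg_int_cases subsetI)
  moreover have "generate ?G ?S \<subseteq> carrier ?G" using sub by (rule generate_incl)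
  ultimately show ?thesis
    using sub inv_image by (auto simp: cayley_subset_def middle_segment_def)
qed

lemma Re_cayley_eigenvalue_1:
  "Re (cayley_eigenvalue m S 1) = (\<Sum>a\<in>S. cos (2 * pi * of_int a / real m))"
  by (simp add: cayley_eigenvalue_def Re_exp)

text \<open>Up to sign the eigenvalue is that of the interval, whose real part is 1 plus twice a sum
  of cosines. The quadratic bound on the cosine reduces it to a sum of squares.\<close>

lemma norm_cayley_eigenvalue_middle_segment_ge:
  assumes "2 * t + 3 \<le> m"
  shows "real (2 * t + 1) * (1 - 2 * pi\<^sup>2 * real t * (real t + 1) / (3 * (real m)\<^sup>2))
    \<le> norm (cayley_eigenvalue m (middle_segment m t) 1)"
proof -
  let ?T = "{0..<int m} - middle_segment m t"
  let ?c = "\<lambda>a :: int. cos (2 * pi * of_int a / real m)"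
  have T: "?T = {0..int t} \<union> {int m - int t..int m - 1}"
    using assms by (auto simp: middle_segment_def)
  have sub: "middle_segment m t \<subseteq> {0..<int m}" by (auto simp: middle_segment_def)
  have refl: "?c (int m - a) = ?c a" for a
  proof -
    have "2 * pi * of_int (int m - a) / real m = 2 * pi - 2 * pi * of_int a / real m"
      using assms by (simp add: field_simps)
    then show ?thesis by (simp add: cos_diff)
  qed
  have "Re (cayley_eigenvalue m ?T 1) = (\<Sum>a\<in>{0..int t}. ?c a) + (\<Sum>a\<in>{int m - int t..int m - 1}. ?c a)"
    unfolding T Re_cayley_eigenvalue_1 using assms by (intro sum.union_disjoint) auto
  also have "(\<Sum>a\<in>{int m - int t..int m - 1}. ?c a) = (\<Sum>a\<in>{1..int t}. ?c a)"
    by (rule sum.reindex_bij_witness[where i = "\<lambda>a. int m - a" and j = "\<lambda>a. int m - a"])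
       (auto simp: refl simp del: of_int_diff)
  also have "{0..int t} = insert 0 {1..int t}" by auto
  finally have "Re (cayley_eigenvalue m ?T 1) = 1 + 2 * (\<Sum>a\<in>{1..int t}. ?c a)" by simp
  also have "(\<Sum>a\<in>{1..int t}. ?c a) = (\<Sum>a=1..t. cos (2 * pi * real a / real m))"
    by (rule sum.reindex_bij_witness[where i = int and j = nat]) auto
  finally have eq: "Re (cayley_eigenvalue m ?T 1) = 1 + 2 * (\<Sum>a=1..t. cos (2 * pi * real a / real m))" .
  have squares: "(\<Sum>a=1..t. (real a)\<^sup>2) = real t * (real t + 1) * (2 * real t + 1) / 6"
    by (induction t) (auto simp: field_simps power2_eq_square)
  have "(\<Sum>a=1..t. 1 - 2 * pi\<^sup>2 / (real m)\<^sup>2 * (real a)\<^sup>2) \<le> (\<Sum>a=1..t. cos (2 * pi * real a / real m))"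
  proof (rule sum_mono)
    fix a
    show "1 - 2 * pi\<^sup>2 / (real m)\<^sup>2 * (real a)\<^sup>2 \<le> cos (2 * pi * real a / real m)"
      using cos_ge_one_minus_square_half[of "2 * pi * real a / real m"]
      by (simp add: power_divide power_mult_distrib)
  qed
  then have "real t - 2 * pi\<^sup>2 / (real m)\<^sup>2 * (real t * (real t + 1) * (2 * real t + 1) / 6)
      \<le> (\<Sum>a=1..t. cos (2 * pi * real a / real m))"
    by (simp only: sum_subtractf flip: sum_distrib_left squares) simp
  then have "real (2 * t + 1) * (1 - 2 * pi\<^sup>2 * real t * (real t + 1) / (3 * (real m)\<^sup>2))
      \<le> Re (cayley_eigenvalue m ?T 1)"
    unfolding eq using assms by (simp add: field_simps)
  also have "\<dots> \<le> norm (cayley_eigenvalue m ?T 1)" by (rule complex_Re_le_cmod)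
  also have "\<dots> = norm (cayley_eigenvalue m (middle_segment m t) 1)"
    using cayley_eigenvalue_complement[OF sub, of 1] assms by simp
  finally show ?thesis .
qed

section \<open>Gaps between \<open>4 m\<close> and the next odd square\<close>

text \<open>The constant \<open>100\<close> exceeds both the discriminants \<open>25 - 4 c \<le> 45\<close> of the polynomials defining
  \<^const>\<open>J\<close> and the loss \<open>16 \<pi>\<^sup>2 / 3 < 86\<close> incurred by estimating the eigenvalue of an interval.\<close>

definition odd_square_gap :: "nat \<Rightarrow> bool" where
  "odd_square_gap m \<longleftrightarrow> (\<forall>x. odd x \<longrightarrow> 4 * m < x\<^sup>2 \<longrightarrow> 4 * m + 100 \<le> x\<^sup>2)"

text \<open>The eigenvalue is at least \<open>L * (1 - q)\<close>, so the Ramanujan bound would give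
  \<open>(L + 2)^2 - 4 * m <= 2 * q * L^2 <= 8 * q * m <= 256 / 3\<close>, against a gap of
  100.\<close>

lemma not_ramanujan_middle_segment:
  assumes m: "m \<ge> 31" and t: "real t + 1 / 2 \<le> sqrt (real m)"
    and gap: "4 * m + 100 \<le> (2 * t + 3)\<^sup>2"
  shows "\<not> ramanujan m (middle_segment m t)"
proof
  define s where "s = sqrt (real m)"
  have s2: "s\<^sup>2 = real m" by (simp add: s_def)
  have s5: "5 \<le> s" unfolding s_def using m by (intro real_le_rsqrt) auto
  have ts: "real t + 1 / 2 \<le> s" using t by (simp add: s_def)
  have "5 * s \<le> real m" using s5 unfolding s2[symmetric] power2_eq_square by (intro mult_right_mono) auto
  then have "real (2 * t + 3) \<le> real m" using ts s5 by simp
  then have tm: "2 * t + 3 \<le> m" by (simp only: of_nat_le_iff)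
  define L where "L = real (2 * t + 1)"
  define q where "q = 2 * pi\<^sup>2 * real t * (real t + 1) / (3 * (real m)\<^sup>2)"
  have L2: "L\<^sup>2 \<le> 4 * real m"
  proof -
    have "L \<le> 2 * s" using ts by (simp add: L_def)
    then have "L\<^sup>2 \<le> (2 * s)\<^sup>2" by (intro power_mono) (auto simp: L_def)
    then show ?thesis by (simp add: power_mult_distrib s2)
  qed
  have q0: "q \<ge> 0" by (simp add: q_def)
  have qm: "q * real m \<le> 32 / 3"
  proof -
    have "real t * (real t + 1) \<le> (real t + 1 / 2)\<^sup>2"
      by (simp add: power2_eq_square algebra_simps)
    also have "\<dots> \<le> s\<^sup>2" using ts by (intro power_mono) auto
    finally have tt: "real t * (real t + 1) \<le> real m" by (simp add: s2)
    have "pi\<^sup>2 \<le> 4\<^sup>2" using pi_less_4 by (intro power_mono) auto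
    then have "pi\<^sup>2 * (real t * (real t + 1)) \<le> 16 * real m"
      using tt by (intro mult_mono) auto
    moreover have "q * real m = 2 * (pi\<^sup>2 * (real t * (real t + 1))) / (3 * real m)"
      using m by (simp add: q_def power2_eq_square)
    ultimately show ?thesis using m by (simp add: divide_le_eq mult_ac)
  qed
  \<comment> \<open>Needed for \<open>1 - q\<close> to be nonnegative, so that the inequality can be
    squared.\<close>
  have "q * 31 \<le> q * real m" using q0 m by (intro mult_left_mono) auto
  then have q1: "q \<le> 1" using qm by simp
  have card: "real (card (middle_segment m t)) = real m - L"
    using tm by (simp add: middle_segment_def L_def nat_diff_distrib of_nat_diff)
  assume "ramanujan m (middle_segment m t)"
  then have "cayley_mu m (middle_segment m t) \<le> 2 * sqrt (real m - L - 1)"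
    by (simp add: ramanujan_def card)
  moreover have "norm (cayley_eigenvalue m (middle_segment m t) 1) \<le> cayley_mu m (middle_segment m t)"
    unfolding cayley_mu_def using m by (intro Max_ge) auto
  ultimately have "L * (1 - q) \<le> 2 * sqrt (real m - L - 1)"
    using norm_cayley_eigenvalue_middle_segment_ge[OF tm] by (simp add: L_def q_def)
  then have "(L * (1 - q))\<^sup>2 \<le> (2 * sqrt (real m - L - 1))\<^sup>2"
    using q1 by (intro power_mono) (auto simp: L_def)
  also have "\<dots> = 4 * (real m - L - 1)"
    using tm by (simp add: power_mult_distrib L_def)
  finally have "L\<^sup>2 * (1 - q)\<^sup>2 \<le> 4 * (real m - L - 1)" by (simp add: power_mult_distrib)
  moreover have "L\<^sup>2 * (1 - 2 * q) \<le> L\<^sup>2 * (1 - q)\<^sup>2"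
    by (intro mult_left_mono) (auto simp: power2_diff)
  moreover have "L\<^sup>2 * q \<le> 4 * real m * q" using L2 q0 by (intro mult_right_mono)
  ultimately have "(L + 2)\<^sup>2 - 4 * real m \<le> 8 * (q * real m)"
    by (simp add: power2_sum algebra_simps)
  moreover have "real (4 * m + 100) \<le> real ((2 * t + 3)\<^sup>2)" using gap by (simp only: of_nat_le_iff)
  then have "4 * real m + 100 \<le> (L + 2)\<^sup>2" by (simp add: L_def add.commute)
  ultimately show False using qm by simp
qed

text \<open>For \<open>2 * t + 1 = l_zero m\<close>, the number \<open>4 * m\<close> lies between
  the consecutive odd squares \<open>(2 * t + 3)^2\<close> and \<open>(2 * t + 5)^2\<close>. The gap
  makes the next odd covalency \<open>2 * t + 3\<close> fail.\<close>

lemma ordinary_if_odd_square_gap: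
  assumes odd: "odd m" and m: "m \<ge> 31" and gap: "odd_square_gap m"
  shows "ordinary m"
proof -
  define s where "s = sqrt (real m)"
  have s2: "s\<^sup>2 = real m" by (simp add: s_def)
  have s5: "5 \<le> s" unfolding s_def using m by (intro real_le_rsqrt) auto
  define t where "t = nat \<lfloor>s - 3 / 2\<rfloor>"
  have "0 \<le> \<lfloor>s - 3 / 2\<rfloor>" using s5 by simp
  then have t: "int t = \<lfloor>s - 3 / 2\<rfloor>" by (simp add: t_def)
  then have t1: "real t + 3 / 2 \<le> s" and t2: "s < real t + 5 / 2" by linarith+
  have "5 * s \<le> real m" using s5 unfolding s2[symmetric] power2_eq_square by (intro mult_right_mono) auto
  then have "real (2 * t + 5) \<le> real m" using t1 s5 by simp
  then have tm: "2 * t + 5 \<le> m" by (simp only: of_nat_le_iff)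
  have "(2 * s)\<^sup>2 < (2 * real t + 5)\<^sup>2" using t2 s5 by (intro power_strict_mono) auto
  then have "real (4 * m) < real ((2 * t + 5)\<^sup>2)" by (simp add: power_mult_distrib s2 add.commute)
  then have "4 * m < (2 * t + 5)\<^sup>2" by (simp only: of_nat_less_iff)
  then have "4 * m + 100 \<le> (2 * (t + 1) + 3)\<^sup>2"
    using gap[unfolded odd_square_gap_def, rule_format, of "2 * t + 5"] by (simp add: algebra_simps)
  then have bad: "\<not> ramanujan m (middle_segment m (t + 1))"
    using t1 by (intro not_ramanujan_middle_segment[OF m]) (simp_all add: s_def)
  have "(2 * real t + 3)\<^sup>2 \<le> (2 * s)\<^sup>2" using t1 by (intro power_mono) auto
  then have "real ((2 * t + 3)\<^sup>2) \<le> real (4 * m)" by (simp add: power_mult_distrib s2 add.commute)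
  then have sq: "(2 * t + 3)\<^sup>2 \<le> 4 * m" by (simp only: of_nat_le_iff)
  define A where "A = {l. (\<exists>S. cayley_subset m S \<and> covalency m S = l) \<and>
                     (\<forall>S. cayley_subset m S \<and> covalency m S \<le> l \<longrightarrow> ramanujan m S)}"
  have "Max A = 2 * t + 1"
  proof (rule Max_eqI)
    show "finite A" by (rule finite_subset[of _ "{..m}"]) (auto simp: A_def covalency_def)
    show "l \<le> 2 * t + 1" if "l \<in> A" for l
    proof (rule ccontr)
      assume l: "\<not> l \<le> 2 * t + 1"
      from that obtain S where S: "cayley_subset m S" "covalency m S = l"
        and ram: "\<And>S. cayley_subset m S \<Longrightarrow> covalency m S \<le> l \<Longrightarrow> ramanujan m S"
        by (auto simp: A_def)
      have "odd l"
        using card_cayley_subset_even[OF odd S(1)] S(2) odd l by (auto simp: covalency_def)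
      then have "2 * (t + 1) + 1 \<le> l" using l by presburger
      then show False
        using ram[OF cayley_subset_middle_segment[OF odd]] covalency_middle_segment[of "t + 1" m] tm bad
        by simp
    qed
    have "ramanujan m S" if "cayley_subset m S" "covalency m S \<le> 2 * t + 1" for S
    proof (rule ramanujan_if_small_covalency)
      have "(covalency m S + 2)\<^sup>2 \<le> (2 * t + 3)\<^sup>2" using that by (intro power_mono) auto
      then show "(covalency m S + 2)\<^sup>2 \<le> 4 * m" using sq by linarith
    qed (use that m in auto)
    then show "2 * t + 1 \<in> A"
      using cayley_subset_middle_segment[OF odd, of t] covalency_middle_segment[of t m] tm
      by (auto simp: A_def intro!: exI[of _ "middle_segment m t"])
  qed
  then have "int (hat_l m) = l_zero m"
    using t by (simp add: hat_l_def A_def l_zero_def s_def)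
  then show ?thesis using odd m by (simp add: ordinary_def)
qed

text \<open>Completing the square,
  \<open>4 * (k^2 + 5 * k + c) = (2 * k + 5)^2 - (25 - 4 * c)\<close> lies between 5 and 45 below an
  odd square. The remaining family ends at 29.\<close>

lemma notin_J_if_odd_square_gap:
  assumes "m \<ge> 31" "odd_square_gap m"
  shows "int m \<notin> J"
proof
  have False if k: "4 \<le> k" "int m = k\<^sup>2 + 5 * k + c" "-5 \<le> c" "c \<le> 5" for k c :: int
  proof -
    define x where "x = nat (2 * k + 5)"
    have x: "int x = 2 * k + 5" using k by (simp add: x_def)
    have "int (x\<^sup>2) = int (4 * m) + 25 - 4 * c"
      using k(2) by (simp add: x power2_eq_square algebra_simps)
    then have "4 * m < x\<^sup>2" "x\<^sup>2 < 4 * m + 100" using k by linarith+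
    moreover have "odd x" using x by presburger
    ultimately show False using assms(2) by (auto simp: odd_square_gap_def not_less[symmetric])
  qed
  note * = this
  assume "int m \<in> J"
  then consider n where "int m = 2 * n + 1" "n \<le> 14"
    | k c where "4 \<le> k" "int m = k\<^sup>2 + 5 * k + c" "c \<in> {-1, 1, -3, 3, 5}"
    | k where "19 \<le> k" "int m = k\<^sup>2 + 5 * k - 5"
    unfolding J_def by blast
  then show False
  proof cases
    case 1
    then show False using assms(1) by linarith
  next
    case (2 k c)
    then show False by (intro *[of k c]) auto
  next
    case (3 k)
    then show False by (intro *[of k "-5"]) auto
  qed
qed

section \<open>Primes and products of two primes with the gap property\<close>

lemma infinite_primes_odd_square_gap: "infinite {p. prime p \<and> odd_square_gap p}"
proof -
  define B where "B = {p :: nat. prime p \<and> \<not> odd_square_gap p}"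
  define P where "P = (\<lambda>p (x, e). x\<^sup>2 = 4 * p + (e :: nat) \<and> e < 100 \<and> 0 < (x :: nat))"
  have ex: "\<exists>y. P p y" if p: "p \<in> B" for p
  proof -
    obtain x where "odd x" "4 * p < x\<^sup>2" "x\<^sup>2 < 4 * p + 100"
      using p unfolding B_def odd_square_gap_def mem_Collect_eq by (metis not_le)
    moreover from this(1) have "0 < x" by (rule odd_pos)
    ultimately have "P p (x, x\<^sup>2 - 4 * p)" unfolding P_def by simp
    then show ?thesis by blast
  qed
  define g where "g = (\<lambda>p. SOME y. P p y)"
  have g: "P p (g p)" if "p \<in> B" for p
    using someI_ex[OF ex[OF that]] by (simp add: g_def)
  \<comment> \<open>Since \<open>e < 100\<close>, this encodes the pair \<open>(x, e)\<close>
    injectively, and the pair determines \<open>p\<close>.\<close>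
  define f where "f = (\<lambda>p. 100 * fst (g p) + snd (g p))"
  have "infinite ({p. prime p} - B)"
  \<comment> \<open>The constant is \<open>200^2 * 104\<close>, from \<open>f p <= 200 * x\<close>
    and \<open>x^2 = 4 * p + e <= 104 * p\<close>.\<close>
  proof (rule infinite_primes_outside_sparse[where f = f and C = 4160000])
    show "inj_on f B"
    proof (rule inj_onI)
      fix p q assume pq: "p \<in> B" "q \<in> B" "f p = f q"
      obtain x e y d where xy: "g p = (x, e)" "g q = (y, d)" by fastforce
      have P: "P p (x, e)" "P q (y, d)" using g pq xy by metis+
      have eq: "100 * x + e = 100 * y + d" using pq xy by (simp add: f_def)
      moreover have "e < 100" "d < 100" using P by (auto simp: P_def)
      ultimately have "x = y" by linarith
      moreover from this eq have "e = d" by simp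
      ultimately show "p = q" using P by (simp add: P_def)
    qed
    fix p assume p: "p \<in> B"
    obtain x e where xe: "g p = (x, e)" by fastforce
    have P: "x\<^sup>2 = 4 * p + e" "e < 100" "0 < x" using g[OF p] xe by (auto simp: P_def)
    have p0: "0 < p" using p by (simp add: B_def prime_gt_0_nat)
    then show "0 < p \<and> 0 < f p" using P by (simp add: f_def xe)
    have "f p \<le> 200 * x" using P by (simp add: f_def xe)
    then have "(f p)\<^sup>2 \<le> (200 * x)\<^sup>2" by (intro power_mono) auto
    also have "\<dots> = 40000 * (4 * p + e)" using P by (simp add: power_mult_distrib)
    also have "\<dots> \<le> 4160000 * p" using P p0 by simp
    finally show "(f p)\<^sup>2 \<le> 4160000 * p" .
  qed
  moreover have "{p. prime p} - B = {p. prime p \<and> odd_square_gap p}" by (auto simp: B_def)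
  ultimately show ?thesis by simp
qed

lemma odd_square_gap_mult_close:
  assumes "odd p" "odd q" "p < q" "(q - p)\<^sup>2 < p" "50 \<le> p"
  shows "odd_square_gap (p * q)"
  unfolding odd_square_gap_def
proof (intro allI impI)
  fix x assume x: "odd x" "4 * (p * q) < x\<^sup>2"
  define g where "g = q - p"
  have q: "q = p + g" using assms(3) by (simp add: g_def)
  have g: "g\<^sup>2 < p" using assms(4) by (simp add: g_def)
  have key: "(p + q)\<^sup>2 = 4 * (p * q) + g\<^sup>2" unfolding q by (simp add: power2_eq_square algebra_simps)
  txt \<open>\<open>4 p q = (p + q)\<^sup>2 - g\<^sup>2\<close> is so close to the even square \<open>(p + q)\<^sup>2\<close> that the next odd square is
    \<open>(p + q + 1)\<^sup>2\<close>.\<close>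
  have "p + q \<le> x"
  proof (rule ccontr)
    assume "\<not> p + q \<le> x"
    then have "(x + 1)\<^sup>2 \<le> (p + q)\<^sup>2" by (intro power_mono) auto
    then have "x\<^sup>2 + 2 * x + 1 \<le> 4 * (p * q) + g\<^sup>2" unfolding key by (simp add: power2_eq_square)
    then have "2 * x < g\<^sup>2" using x(2) by linarith
    then have "x < p" using g by linarith
    then have "x\<^sup>2 < p\<^sup>2" by (intro power_strict_mono) auto
    moreover have "p\<^sup>2 \<le> p * q" using assms(3) by (simp add: power2_eq_square)
    ultimately show False using x(2) by linarith
  qed
  moreover have "even (p + q)" using assms by simp
  ultimately have "p + q + 1 \<le> x" using x(1) by presburger
  then have "(p + q + 1)\<^sup>2 \<le> x\<^sup>2" by (intro power_mono) auto
  moreover have "(p + q + 1)\<^sup>2 = (p + q)\<^sup>2 + (2 * (p + q) + 1)"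
    by (simp add: power2_eq_square)
  moreover have "4 * (p * q) + 100 \<le> (p + q)\<^sup>2 + (2 * (p + q) + 1)"
    unfolding key using assms(5) by (intro add_mono) auto
  ultimately show "4 * (p * q) + 100 \<le> x\<^sup>2" by linarith
qed

theorem theorem5p1:
  shows "infinite {m :: nat. prime m \<and> odd m \<and> ordinary m \<and> int m \<notin> J} \<and>
         infinite {m :: nat. ordinary m \<and> int m \<notin> J \<and>
           (\<exists>p q :: nat. prime p \<and> prime q \<and> odd p \<and> odd q \<and> p < q \<and> q < 4 * p \<and> m = p * q)}"
proof
  have "infinite ({p. prime p \<and> odd_square_gap p} - {..<31})"
    by (rule Diff_infinite_finite[OF _ infinite_primes_odd_square_gap]) simp
  moreover have "{p. prime p \<and> odd_square_gap p} - {..<31}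
      \<subseteq> {m. prime m \<and> odd m \<and> ordinary m \<and> int m \<notin> J}"
    using prime_odd_nat by (auto simp: not_less ordinary_if_odd_square_gap notin_J_if_odd_square_gap)
  ultimately show "infinite {m :: nat. prime m \<and> odd m \<and> ordinary m \<and> int m \<notin> J}"
    using finite_subset by blast
next
  show "infinite {m :: nat. ordinary m \<and> int m \<notin> J \<and>
      (\<exists>p q :: nat. prime p \<and> prime q \<and> odd p \<and> odd q \<and> p < q \<and> q < 4 * p \<and> m = p * q)}"
    unfolding infinite_nat_iff_unbounded_le
  proof
    fix N :: nat
    \<comment> \<open>The summand \<open>N\<close> gives unboundedness, and 50 serves the gap
      criterion for products.\<close>
    obtain p q :: nat where pq: "prime p" "prime q" "N + 50 \<le> p" "p < q" "(q - p)\<^sup>2 < p"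
      using exists_close_primes by blast
    have odd: "odd p" "odd q" using pq prime_odd_nat by auto
    have gap: "odd_square_gap (p * q)" using odd pq by (intro odd_square_gap_mult_close) auto
    have "p * 1 \<le> p * q" using pq by (intro mult_left_mono) auto
    then have large: "N \<le> p * q" "31 \<le> p * q" using pq by linarith+
    \<comment> \<open>Thus \<open>q - p < p\<close>, so that even \<open>q < 2 * p\<close>
      holds.\<close>
    have "q - p \<le> (q - p)\<^sup>2" unfolding power2_eq_square by (rule le_square)
    then have "q < 4 * p" using pq by linarith
    then show "\<exists>m\<ge>N. m \<in> {m. ordinary m \<and> int m \<notin> J \<and>
        (\<exists>p q. prime p \<and> prime q \<and> odd p \<and> odd q \<and> p < q \<and> q < 4 * p \<and> m = p * q)}"
      using large gap odd pq ordinary_if_odd_square_gap[of "p * q"] notin_J_if_odd_square_gap[of "p * q"]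
      by (intro exI[of _ "p * q"]) auto
  qed
qed

end
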